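(* Let $S$ be a semigroup, let $\beta$ be a congruence on $S$ with $\theta_S\subseteq\beta$, and let $P$ be a choice function on the collection of all $\theta_S$-classes of $S$. Let $P'_\beta: S/\theta_S\to S/\beta$ be the mapping $P'_\beta([s]_{\theta_S})=[s]_\beta$, and let $\mathcal{F}_{\theta_S,\beta}:\mathcal{M}(S;S/\theta_S;P)\to\mathcal{M}(S/\beta;S/\theta_S;P'_\beta)$ be the surjective homomorphism $(a,[s]_{\theta_S})\mapsto([a]_\beta,[s]_{\theta_S})$. Then $\theta_{\mathcal{M}(S;S/\theta_S;P)}$ equals the kernel of $\mathcal{F}_{\theta_S,\beta}$ if and only if $\beta=\theta_S^{*}$. Thus $$\mathcal{M}(S;S/\theta_S;P)/\theta_{\mathcal{M}(S;S/\theta_S;P)}\cong\mathcal{M}(S/\theta_S^{*};S/\theta_S;P'),$$ where $P':S/\theta_S\to S/\theta_S^{*}$ is the surjective mapping defined by $P'([s]_{\theta_S})=[s]_{\theta_S^{*}}$ for every $[s]_{\theta_S}\in S/\theta_S$.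
   Context: For a semigroup $S$, $\theta_S$ is the congruence $\theta_S=\{(a,b)\in S\times S: xa=xb \text{ for all } x\in S\}$ (the kernel of the right regular representation of $S$). For a congruence $\varrho$ on $S$, the right colon congruence of $\varrho$ is the congruence $\varrho^{*}=\{(a,b)\in S\times S: (sa,sb)\in\varrho\text{ for all } s\in S\}$; one has $\varrho\subseteq\varrho^{*}$. $\theta_S^{*}$ is the right colon congruence of $\theta_S$. $[s]_\varrho$ denotes the $\varrho$-class of $s$. The kernel of a homomorphism $f$ is the congruence $\{(u,v): f(u)=f(v)\}$. For a semigroup $S$, a nonempty set $\Lambda$ and a mapping $P:\Lambda\to S$, $\mathcal{M}(S;\Lambda;P)$ denotes the Rees matrix semigroup whose underlying set is $S\times\Lambda$, with multiplication $(s,\lambda)(t,\mu)=(sP(\lambda)t,\mu)$. A choice function on the collection of all $\theta_S$-classes of $S$ is a mapping $P:S/\theta_S\to S$ with $P([s]_{\theta_S})\in[s]_{\theta_S}$ for every $s\in S$. *)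

theory Defs
  imports "HOL-Algebra.Congruence"
begin

record 'a magma = "'a partial_object" +
  mult :: "['a, 'a] \<Rightarrow> 'a" (infixl \<open>\<cdot>\<index>\<close> 70)

locale semigrp =
  fixes S :: "'a magma" (structure)
  assumes nonempty: "carrier S \<noteq> {}"
    and closed: "\<lbrakk>x \<in> carrier S; y \<in> carrier S\<rbrakk> \<Longrightarrow> x \<cdot> y \<in> carrier S"
    and assoc: "\<lbrakk>x \<in> carrier S; y \<in> carrier S; z \<in> carrier S\<rbrakk> \<Longrightarrow> (x \<cdot> y) \<cdot> z = x \<cdot> (y \<cdot> z)"

definition congruence :: "'a magma \<Rightarrow> ('a \<times> 'a) set \<Rightarrow> bool" where
  "congruence S \<rho> \<longleftrightarrow> equiv (carrier S) \<rho> \<and>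
     (\<forall>(a, b) \<in> \<rho>. \<forall>c \<in> carrier S.
        (c \<cdot>\<^bsub>S\<^esub> a, c \<cdot>\<^bsub>S\<^esub> b) \<in> \<rho> \<and> (a \<cdot>\<^bsub>S\<^esub> c, b \<cdot>\<^bsub>S\<^esub> c) \<in> \<rho>)"

definition magma_hom :: "'a magma \<Rightarrow> 'b magma \<Rightarrow> ('a \<Rightarrow> 'b) set" where
  "magma_hom S T = {f. f \<in> carrier S \<rightarrow> carrier T \<and>
     (\<forall>x \<in> carrier S. \<forall>y \<in> carrier S. f (x \<cdot>\<^bsub>S\<^esub> y) = f x \<cdot>\<^bsub>T\<^esub> f y)}"

definition magma_isomorphic :: "'a magma \<Rightarrow> 'b magma \<Rightarrow> bool" where
  "magma_isomorphic S T \<longleftrightarrow> (\<exists>f \<in> magma_hom S T. bij_betw f (carrier S) (carrier T))"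

definition hom_kernel :: "'a magma \<Rightarrow> ('a \<Rightarrow> 'b) \<Rightarrow> ('a \<times> 'a) set" where
  "hom_kernel S f = {(u, v) \<in> carrier S \<times> carrier S. f u = f v}"

text \<open>As usual in \<^theory>\<open>HOL.Equiv_Relations\<close>, the class of \<open>s\<close> modulo \<open>\<rho>\<close> is \<open>\<rho> `` {s}\<close> and
  the set of all classes is \<open>carrier S // \<rho>\<close>. The union below collapses to the single class
  of any product of representatives; see \<open>quotient_mult\<close>.\<close>

definition quotient_magma :: "'a magma \<Rightarrow> ('a \<times> 'a) set \<Rightarrow> 'a set magma" where
  "quotient_magma S \<rho> =
     \<lparr>carrier = carrier S // \<rho>,
      mult = (\<lambda>A B. \<Union>a\<in>A. \<Union>b\<in>B. \<rho> `` {a \<cdot>\<^bsub>S\<^esub> b})\<rparr>"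

definition theta :: "'a magma \<Rightarrow> ('a \<times> 'a) set" where
  "theta S = {(a, b) \<in> carrier S \<times> carrier S. \<forall>x \<in> carrier S. x \<cdot>\<^bsub>S\<^esub> a = x \<cdot>\<^bsub>S\<^esub> b}"

definition right_colon :: "'a magma \<Rightarrow> ('a \<times> 'a) set \<Rightarrow> ('a \<times> 'a) set" where
  "right_colon S \<rho> =
     {(a, b) \<in> carrier S \<times> carrier S. \<forall>s \<in> carrier S. (s \<cdot>\<^bsub>S\<^esub> a, s \<cdot>\<^bsub>S\<^esub> b) \<in> \<rho>}"

definition rees_matrix :: "'a magma \<Rightarrow> 'i set \<Rightarrow> ('i \<Rightarrow> 'a) \<Rightarrow> ('a \<times> 'i) magma" where
  "rees_matrix S \<Lambda> P =
     \<lparr>carrier = carrier S \<times> \<Lambda>,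
      mult = (\<lambda>(s, l) (t, m). (s \<cdot>\<^bsub>S\<^esub> P l \<cdot>\<^bsub>S\<^esub> t, m))\<rparr>"

definition theta_choice :: "'a magma \<Rightarrow> ('a set \<Rightarrow> 'a) \<Rightarrow> bool" where
  "theta_choice S P \<longleftrightarrow> (\<forall>s \<in> carrier S. P (theta S `` {s}) \<in> theta S `` {s})"

text \<open>For a congruence \<open>\<beta>\<close> containing \<open>\<rho>\<close>, the map \<open>class_map \<beta>\<close> sends each \<open>\<rho>\<close>-class to the
  \<open>\<beta>\<close>-class including it; see \<open>class_map_class\<close>.\<close>

definition class_map :: "('a \<times> 'a) set \<Rightarrow> 'a set \<Rightarrow> 'a set" where
  "class_map \<beta> A = \<beta> `` A"

definition rees_map :: "('a \<times> 'a) set \<Rightarrow> 'a \<times> 'i \<Rightarrow> 'a set \<times> 'i" where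
  "rees_map \<beta> = (\<lambda>(a, l). (\<beta> `` {a}, l))"

lemma congruence_equiv: "congruence S \<rho> \<Longrightarrow> equiv (carrier S) \<rho>"
  by (simp add: congruence_def)

lemma congruence_mult:
  assumes S: "semigrp S" and c: "congruence S \<rho>" and ab: "(a, b) \<in> \<rho>" and uv: "(u, v) \<in> \<rho>"
  shows "(a \<cdot>\<^bsub>S\<^esub> u, b \<cdot>\<^bsub>S\<^esub> v) \<in> \<rho>"
proof -
  have e: "equiv (carrier S) \<rho>" using c by (rule congruence_equiv)
  then have "b \<in> carrier S" "u \<in> carrier S"
    using ab uv by (auto simp: equiv_def)
  then have "(a \<cdot>\<^bsub>S\<^esub> u, b \<cdot>\<^bsub>S\<^esub> u) \<in> \<rho>" "(b \<cdot>\<^bsub>S\<^esub> u, b \<cdot>\<^bsub>S\<^esub> v) \<in> \<rho>"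
    using c ab uv unfolding congruence_def by fast+
  moreover have "trans \<rho>" using e by (simp add: equiv_def)
  ultimately show ?thesis by (meson transD)
qed

lemma quotient_mult:
  assumes "semigrp S" "congruence S \<rho>" "a \<in> carrier S" "b \<in> carrier S"
  shows "(\<rho> `` {a}) \<cdot>\<^bsub>quotient_magma S \<rho>\<^esub> (\<rho> `` {b}) = \<rho> `` {a \<cdot>\<^bsub>S\<^esub> b}"
proof -
  have e: "equiv (carrier S) \<rho>" using assms(2) by (rule congruence_equiv)
  have "\<rho> `` {x \<cdot>\<^bsub>S\<^esub> y} = \<rho> `` {a \<cdot>\<^bsub>S\<^esub> b}" if "x \<in> \<rho> `` {a}" "y \<in> \<rho> `` {b}" for x y
    using congruence_mult[OF assms(1,2), of a x b y] that equiv_class_eq[OF e] by blast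
  moreover have "a \<in> \<rho> `` {a}" "b \<in> \<rho> `` {b}"
    using equiv_class_self[OF e] assms by auto
  ultimately show ?thesis unfolding quotient_magma_def magma.select_convs by blast
qed

lemma class_map_class:
  assumes "equiv A \<beta>" "\<rho> \<subseteq> \<beta>" "equiv A \<rho>" "s \<in> A"
  shows "class_map \<beta> (\<rho> `` {s}) = \<beta> `` {s}"
proof -
  have "s \<in> \<rho> `` {s}" using equiv_class_self[OF assms(3,4)] .
  moreover have "\<beta> `` {x} = \<beta> `` {s}" if "x \<in> \<rho> `` {s}" for x
    using that assms(2) equiv_class_eq[OF assms(1)] by blast
  ultimately show ?thesis unfolding class_map_def by blast
qed

lemma theta_congruence:
  fixes S (structure)
  assumes "semigrp S"
  shows "congruence S (theta S)"
proof -
  interpret semigrp S by fact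
  have "equiv (carrier S) (theta S)"
    by (rule equivI) (auto simp: theta_def refl_on_def sym_def trans_def)
  moreover have "x \<cdot> (c \<cdot> a) = x \<cdot> (c \<cdot> b)" "x \<cdot> (a \<cdot> c) = x \<cdot> (b \<cdot> c)"
    if "(a, b) \<in> theta S" "c \<in> carrier S" "x \<in> carrier S" for a b c x
  proof -
    have ab: "a \<in> carrier S" "b \<in> carrier S" and *: "\<And>y. y \<in> carrier S \<Longrightarrow> y \<cdot> a = y \<cdot> b"
      using that(1) by (auto simp: theta_def)
    show "x \<cdot> (c \<cdot> a) = x \<cdot> (c \<cdot> b)"
      using *[of "x \<cdot> c"] that ab by (simp add: assoc closed)
    show "x \<cdot> (a \<cdot> c) = x \<cdot> (b \<cdot> c)"
      using *[of x] that ab assoc[of x a c] assoc[of x b c] by simp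
  qed
  moreover have "theta S \<subseteq> carrier S \<times> carrier S" by (auto simp: theta_def)
  ultimately show ?thesis
    unfolding congruence_def by (auto simp: theta_def closed)
qed

lemma right_colon_congruence:
  fixes S (structure)
  assumes "semigrp S" "congruence S \<rho>"
  shows "congruence S (right_colon S \<rho>)"
proof -
  interpret semigrp S by fact
  have e: "equiv (carrier S) \<rho>" using assms(2) by (rule congruence_equiv)
  then have r: "\<And>x. x \<in> carrier S \<Longrightarrow> (x, x) \<in> \<rho>" and s: "sym \<rho>" and t: "trans \<rho>"
    by (auto simp: equiv_def refl_on_def)
  have "equiv (carrier S) (right_colon S \<rho>)"
  proof (rule equivI)
    show "right_colon S \<rho> \<subseteq> carrier S \<times> carrier S" by (auto simp: right_colon_def)
    show "refl_on (carrier S) (right_colon S \<rho>)"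
      by (auto simp: right_colon_def refl_on_def closed r)
    show "sym (right_colon S \<rho>)"
      using s by (auto simp: right_colon_def sym_def)
    show "trans (right_colon S \<rho>)"
      using t unfolding right_colon_def trans_def by blast
  qed
  moreover have "(x \<cdot> (c \<cdot> a), x \<cdot> (c \<cdot> b)) \<in> \<rho>" "(x \<cdot> (a \<cdot> c), x \<cdot> (b \<cdot> c)) \<in> \<rho>"
    if "(a, b) \<in> right_colon S \<rho>" "c \<in> carrier S" "x \<in> carrier S" for a b c x
  proof -
    have ab: "a \<in> carrier S" "b \<in> carrier S"
      and *: "\<And>y. y \<in> carrier S \<Longrightarrow> (y \<cdot> a, y \<cdot> b) \<in> \<rho>"
      using that(1) by (auto simp: right_colon_def)
    show "(x \<cdot> (c \<cdot> a), x \<cdot> (c \<cdot> b)) \<in> \<rho>"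
      using *[of "x \<cdot> c"] that ab by (simp add: assoc closed)
    show "(x \<cdot> (a \<cdot> c), x \<cdot> (b \<cdot> c)) \<in> \<rho>"
      using congruence_mult[OF assms *[of x] r[of c]] that ab by (simp add: assoc)
  qed
  ultimately show ?thesis
    unfolding congruence_def by (auto simp: right_colon_def closed)
qed

lemma subset_right_colon: "congruence S \<rho> \<Longrightarrow> \<rho> \<subseteq> right_colon S \<rho>"
  unfolding congruence_def right_colon_def equiv_def by blast

lemma quotient_semigrp:
  assumes "semigrp S" "congruence S \<rho>"
  shows "semigrp (quotient_magma S \<rho>)"
proof -
  interpret semigrp S by fact
  have c: "carrier (quotient_magma S \<rho>) = carrier S // \<rho>" by (simp add: quotient_magma_def)
  show ?thesis
  proof
    show "carrier (quotient_magma S \<rho>) \<noteq> {}"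
      using nonempty by (simp add: c)
  qed (auto simp: c quotient_mult[OF assms] closed assoc intro!: quotientI elim!: quotientE)
qed

lemma rees_matrix_semigrp:
  fixes S (structure)
  assumes "semigrp S" "\<Lambda> \<noteq> {}" "P \<in> \<Lambda> \<rightarrow> carrier S"
  shows "semigrp (rees_matrix S \<Lambda> P)"
proof -
  interpret semigrp S by fact
  have P: "P l \<in> carrier S" if "l \<in> \<Lambda>" for l
    using assms(3) that by (rule funcset_mem)
  show ?thesis
    by standard (use assms(2) nonempty in \<open>auto simp: rees_matrix_def closed assoc P\<close>)
qed

end

theory Submission
  imports Defs
begin

text \<open>The right regular representation of the Rees matrix semigroup \<open>M\<close> sees an element \<open>(a, l)\<close>
  only through its index \<open>l\<close> and the products \<open>x P(k) a\<close>. A choice function picks \<open>P(k)\<close> from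
  the \<open>\<theta>\<close>-class \<open>k\<close>, and \<open>\<theta>\<close>-related elements are interchangeable as right factors, so the
  products \<open>x P(k)\<close> are exactly the products \<open>x y\<close> with \<open>x\<close> and \<open>y\<close> in \<open>S\<close>. Hence
  \<open>(a, l)\<close> and \<open>(b, m)\<close> are \<open>\<theta>\<close>-related in \<open>M\<close> if and only if \<open>l = m\<close> and \<open>x y a = x y b\<close> for
  all \<open>x\<close>, \<open>y\<close>, that is, \<open>a\<close> and \<open>b\<close> are related by the right colon congruence of \<open>\<theta>\<close>
  (\<open>theta_rees_matrix\<close>).

  On the other side, the kernel of \<open>rees_map \<beta>\<close> relates \<open>(a, l)\<close> and \<open>(b, m)\<close> if and only if \<open>l = m\<close>
  and \<open>a\<close> and \<open>b\<close> are \<open>\<beta>\<close>-related (\<open>hom_kernel_rees_map\<close>). Since the index set is nonempty, the two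
  relations on \<open>M\<close> agree precisely when the two congruences on \<open>S\<close> do. The isomorphism is then
  the homomorphism theorem (\<open>first_isomorphism\<close>) applied to \<open>rees_map\<close> for the right colon
  congruence of \<open>\<theta>\<close>.\<close>

lemma hom_kernel_congruence:
  assumes "semigrp S" "f \<in> magma_hom S T"
  shows "congruence S (hom_kernel S f)"
proof -
  interpret semigrp S by fact
  have "equiv (carrier S) (hom_kernel S f)"
    by (rule equivI) (auto simp: hom_kernel_def refl_on_def sym_def trans_def)
  then show ?thesis
    using assms(2) by (auto simp: congruence_def hom_kernel_def magma_hom_def closed)
qed

text \<open>The homomorphism theorem: a homomorphism is constant on the classes of its kernel, so its
  value on a class is the only element of the image of that class.\<close>

lemma first_isomorphism:
  assumes "semigrp S" and f: "f \<in> magma_hom S T" and surj: "f ` carrier S = carrier T"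
  shows "magma_isomorphic (quotient_magma S (hom_kernel S f)) T"
proof -
  interpret semigrp S by fact
  let ?K = "hom_kernel S f"
  let ?g = "\<lambda>A. the_elem (f ` A)"
  have K: "congruence S ?K"
    using assms(1) f by (rule hom_kernel_congruence)
  have g: "?g (?K `` {a}) = f a" if "a \<in> carrier S" for a
  proof -
    have "f ` (?K `` {a}) = {f a}"
      using that by (auto simp: hom_kernel_def)
    then show ?thesis by simp
  qed
  have c: "carrier (quotient_magma S ?K) = carrier S // ?K"
    by (simp add: quotient_magma_def)
  have "?g \<in> magma_hom (quotient_magma S ?K) T"
    using f by (auto simp: magma_hom_def c g closed quotient_mult[OF assms(1) K] elim!: quotientE)
  moreover have "inj_on ?g (carrier S // ?K)"
  proof (rule inj_onI)
    fix A B assume AB: "A \<in> carrier S // ?K" "B \<in> carrier S // ?K" "?g A = ?g B"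
    then obtain a b where "a \<in> carrier S" "A = ?K `` {a}" "b \<in> carrier S" "B = ?K `` {b}"
      by (auto elim!: quotientE)
    with AB(3) show "A = B"
      using g by (auto simp: hom_kernel_def)
  qed
  moreover have "?g ` (carrier S // ?K) = carrier T"
  proof -
    have "?g ` (carrier S // ?K) = f ` carrier S"
      using g by (auto simp: quotient_def image_iff)
    then show ?thesis using surj by simp
  qed
  ultimately show ?thesis
    unfolding magma_isomorphic_def bij_betw_def c by blast
qed

lemma hom_kernel_rees_map:
  assumes "equiv (carrier S) \<beta>"
  shows "hom_kernel (rees_matrix S \<Lambda> P) (rees_map \<beta>) =
    {((a, l), (b, m)). (a, b) \<in> \<beta> \<and> l = m \<and> l \<in> \<Lambda>}"
proof -
  have "\<beta> \<subseteq> carrier S \<times> carrier S"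
    using assms by (simp add: equiv_def)
  then show ?thesis
    using eq_equiv_class_iff[OF assms]
    by (auto simp: hom_kernel_def rees_matrix_def rees_map_def)
qed

text \<open>If \<open>y\<close> and \<open>P(k)\<close> are \<open>\<theta>\<close>-related, then \<open>x y = x P(k)\<close> for all \<open>x\<close>. So once the values
  of \<open>P\<close> meet every \<open>\<theta>\<close>-class, agreement of \<open>a\<close> and \<open>b\<close> after left multiplication by all
  \<open>x P(k)\<close> is agreement after left multiplication by all \<open>x y\<close>.\<close>

lemma theta_rees_matrix:
  fixes S (structure)
  assumes "semigrp S" and P: "P \<in> \<Lambda> \<rightarrow> carrier S"
    and meets: "\<And>y. y \<in> carrier S \<Longrightarrow> \<exists>k\<in>\<Lambda>. (y, P k) \<in> theta S"
  shows "theta (rees_matrix S \<Lambda> P) =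
    {((a, l), (b, m)). (a, b) \<in> right_colon S (theta S) \<and> l = m \<and> l \<in> \<Lambda>}"
proof -
  interpret semigrp S by fact
  have PS: "P k \<in> carrier S" if "k \<in> \<Lambda>" for k
    using P that by (rule funcset_mem)
  have products: "(\<forall>x\<in>carrier S. \<forall>k\<in>\<Lambda>. x \<cdot> P k \<cdot> a = x \<cdot> P k \<cdot> b) \<longleftrightarrow>
      (\<forall>y\<in>carrier S. (y \<cdot> a, y \<cdot> b) \<in> theta S)" (is "?L \<longleftrightarrow> ?R")
    if ab: "a \<in> carrier S" "b \<in> carrier S" for a b
  proof
    assume L: ?L
    have "x \<cdot> (y \<cdot> a) = x \<cdot> (y \<cdot> b)" if xy: "x \<in> carrier S" "y \<in> carrier S" for x y
    proof -
      obtain k where "k \<in> \<Lambda>" "(y, P k) \<in> theta S"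
        using meets xy(2) by blast
      then have "x \<cdot> y \<cdot> a = x \<cdot> y \<cdot> b"
        using L xy by (simp add: theta_def)
      then show ?thesis
        using ab xy by (simp add: assoc)
    qed
    then show ?R using ab by (simp add: theta_def closed)
  next
    assume ?R
    then show ?L using ab PS by (simp add: theta_def assoc)
  qed
  \<comment> \<open>Nonemptiness of \<open>S\<close> and of \<open>\<Lambda>\<close> lets the equality of the second components force \<open>l = m\<close>.\<close>
  obtain x0 where x0: "x0 \<in> carrier S" using nonempty by blast
  obtain k0 where k0: "k0 \<in> \<Lambda>" using meets x0 by blast
  have "((a, l), (b, m)) \<in> theta (rees_matrix S \<Lambda> P) \<longleftrightarrow>
      (a, b) \<in> right_colon S (theta S) \<and> l = m \<and> l \<in> \<Lambda>" for a b l m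
  proof -
    have "((a, l), (b, m)) \<in> theta (rees_matrix S \<Lambda> P) \<longleftrightarrow>
        a \<in> carrier S \<and> b \<in> carrier S \<and> l \<in> \<Lambda> \<and> m \<in> \<Lambda> \<and>
        (\<forall>x\<in>carrier S. \<forall>k\<in>\<Lambda>. x \<cdot> P k \<cdot> a = x \<cdot> P k \<cdot> b \<and> l = m)"
      unfolding theta_def[of "rees_matrix S \<Lambda> P"]
      by (simp add: rees_matrix_def conj_ac)
    also have "\<dots> \<longleftrightarrow> a \<in> carrier S \<and> b \<in> carrier S \<and> l = m \<and> l \<in> \<Lambda> \<and>
        (\<forall>x\<in>carrier S. \<forall>k\<in>\<Lambda>. x \<cdot> P k \<cdot> a = x \<cdot> P k \<cdot> b)"
      using x0 k0 by blast
    also have "\<dots> \<longleftrightarrow> (a, b) \<in> right_colon S (theta S) \<and> l = m \<and> l \<in> \<Lambda>"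
      using products[of a b] by (auto simp: right_colon_def)
    finally show ?thesis .
  qed
  then show ?thesis by auto
qed

lemma rees_map_hom:
  assumes S: "semigrp S" and \<beta>: "congruence S \<beta>" and P: "P \<in> \<Lambda> \<rightarrow> carrier S"
    and Q: "\<And>l. l \<in> \<Lambda> \<Longrightarrow> Q l = \<beta> `` {P l}"
  shows "rees_map \<beta> \<in> magma_hom (rees_matrix S \<Lambda> P) (rees_matrix (quotient_magma S \<beta>) \<Lambda> Q)"
proof -
  interpret semigrp S by fact
  have PS: "P l \<in> carrier S" if "l \<in> \<Lambda>" for l
    using P that by (rule funcset_mem)
  have c: "carrier (quotient_magma S \<beta>) = carrier S // \<beta>"
    by (simp add: quotient_magma_def)
  show ?thesis
    by (auto simp: magma_hom_def rees_matrix_def rees_map_def c Q PS closed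
        quotient_mult[OF S \<beta>] intro: quotientI)
qed

lemma rees_map_surj:
  "rees_map \<beta> ` carrier (rees_matrix S \<Lambda> P) = carrier (rees_matrix (quotient_magma S \<beta>) \<Lambda> Q)"
  by (force simp: rees_matrix_def rees_map_def quotient_magma_def quotient_def)

lemma theta_choice_in_class:
  assumes "theta_choice S P" "l \<in> carrier S // theta S"
  shows "P l \<in> l"
  using assms by (auto simp: theta_choice_def elim!: quotientE)

text \<open>A \<open>\<beta>\<close>-class over a \<open>\<theta>\<close>-class \<open>l\<close> is determined by any representative of \<open>l\<close>, in particular
  by the chosen one. This identifies the sandwich matrix of the target of \<open>rees_map\<close> with
  the reduction of \<open>P\<close> modulo \<open>\<beta>\<close>.\<close>

lemma class_map_choice:
  assumes S: "semigrp S" and \<beta>: "congruence S \<beta>" and sub: "theta S \<subseteq> \<beta>"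
    and P: "theta_choice S P" and l: "l \<in> carrier S // theta S"
  shows "class_map \<beta> l = \<beta> `` {P l}"
proof -
  have e: "equiv (carrier S) (theta S)"
    using theta_congruence[OF S] by (rule congruence_equiv)
  obtain s where s: "s \<in> carrier S" "l = theta S `` {s}"
    using l by (rule quotientE)
  have "(s, P l) \<in> theta S"
    using theta_choice_in_class[OF P l] s(2) by simp
  then have "(s, P l) \<in> \<beta>" using sub by blast
  then have "\<beta> `` {s} = \<beta> `` {P l}"
    using equiv_class_eq[OF congruence_equiv[OF \<beta>]] by blast
  then show ?thesis
    using class_map_class[OF congruence_equiv[OF \<beta>] sub e s(1)] s(2) by simp
qed

lemma class_map_surj:
  assumes S: "semigrp S" and \<beta>: "congruence S \<beta>" and sub: "theta S \<subseteq> \<beta>"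
  shows "class_map \<beta> ` (carrier S // theta S) = carrier (quotient_magma S \<beta>)"
proof -
  have "class_map \<beta> (theta S `` {s}) = \<beta> `` {s}" if "s \<in> carrier S" for s
    using class_map_class[OF congruence_equiv[OF \<beta>] sub
        congruence_equiv[OF theta_congruence[OF S]] that] .
  then show ?thesis
    by (auto simp: quotient_magma_def quotient_def image_iff)
qed

theorem theorem1:
  fixes S :: "'a magma" and \<beta> :: "('a \<times> 'a) set" and P :: "'a set \<Rightarrow> 'a"
  assumes "semigrp S"
    and "congruence S \<beta>"
    and "theta S \<subseteq> \<beta>"
    and "theta_choice S P"
  defines "\<Lambda> \<equiv> carrier S // theta S"
  defines "M \<equiv> rees_matrix S \<Lambda> P"
  defines "\<theta>s \<equiv> right_colon S (theta S)"
  shows "rees_map \<beta> \<in> magma_hom M (rees_matrix (quotient_magma S \<beta>) \<Lambda> (class_map \<beta>))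
     \<and> rees_map \<beta> ` carrier M = carrier (rees_matrix (quotient_magma S \<beta>) \<Lambda> (class_map \<beta>))
     \<and> (theta M = hom_kernel M (rees_map \<beta>) \<longleftrightarrow> \<beta> = \<theta>s)
     \<and> class_map \<theta>s ` \<Lambda> = carrier (quotient_magma S \<theta>s)
     \<and> magma_isomorphic (quotient_magma M (theta M))
          (rees_matrix (quotient_magma S \<theta>s) \<Lambda> (class_map \<theta>s))"
proof -
  have \<theta>: "congruence S (theta S)"
    using assms(1) by (rule theta_congruence)
  have \<theta>s: "congruence S \<theta>s" and sub: "theta S \<subseteq> \<theta>s"
    unfolding \<theta>s_def using right_colon_congruence[OF assms(1) \<theta>] subset_right_colon[OF \<theta>] by auto
  have in_class: "P l \<in> l" if "l \<in> \<Lambda>" for l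
    using theta_choice_in_class[OF assms(4)] that by (simp add: \<Lambda>_def)
  have P: "P \<in> \<Lambda> \<rightarrow> carrier S"
    using in_class by (fastforce simp: \<Lambda>_def theta_def elim!: quotientE)
  have meets: "\<exists>k\<in>\<Lambda>. (y, P k) \<in> theta S" if "y \<in> carrier S" for y
    using in_class[of "theta S `` {y}"] quotientI[OF that, of "theta S"] by (auto simp: \<Lambda>_def)
  have \<Lambda>: "\<Lambda> \<noteq> {}"
    using semigrp.nonempty[OF assms(1)] by (simp add: \<Lambda>_def)

  have hom: "rees_map \<rho> \<in> magma_hom M (rees_matrix (quotient_magma S \<rho>) \<Lambda> (class_map \<rho>))"
    if "congruence S \<rho>" "theta S \<subseteq> \<rho>" for \<rho>
    unfolding M_def
    using rees_map_hom[OF assms(1) that(1) P] class_map_choice[OF assms(1) that assms(4)]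
    by (simp add: \<Lambda>_def)
  have surj: "rees_map \<rho> ` carrier M = carrier (rees_matrix (quotient_magma S \<rho>) \<Lambda> (class_map \<rho>))"
    for \<rho>
    unfolding M_def by (rule rees_map_surj)
  have thM: "theta M = {((a, l), (b, m)). (a, b) \<in> \<theta>s \<and> l = m \<and> l \<in> \<Lambda>}"
    unfolding M_def \<theta>s_def using theta_rees_matrix[OF assms(1) P meets] .
  have kerM: "hom_kernel M (rees_map \<rho>) = {((a, l), (b, m)). (a, b) \<in> \<rho> \<and> l = m \<and> l \<in> \<Lambda>}"
    if "congruence S \<rho>" for \<rho>
    unfolding M_def using hom_kernel_rees_map[OF congruence_equiv[OF that]] .

  have iff: "theta M = hom_kernel M (rees_map \<beta>) \<longleftrightarrow> \<beta> = \<theta>s"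
  proof
    assume eq: "theta M = hom_kernel M (rees_map \<beta>)"
    obtain l where l: "l \<in> \<Lambda>" using \<Lambda> by blast
    have "(a, b) \<in> \<beta> \<longleftrightarrow> (a, b) \<in> \<theta>s" for a b
    proof -
      have "((a, l), (b, l)) \<in> theta M \<longleftrightarrow> ((a, l), (b, l)) \<in> hom_kernel M (rees_map \<beta>)"
        using eq by simp
      then show ?thesis
        using l by (simp add: thM kerM[OF assms(2)])
    qed
    then show "\<beta> = \<theta>s" by auto
  next
    assume "\<beta> = \<theta>s"
    then show "theta M = hom_kernel M (rees_map \<beta>)"
      using thM kerM[OF assms(2)] by simp
  qed

  have M: "semigrp M"
    unfolding M_def using assms(1) \<Lambda> P by (rule rees_matrix_semigrp)
  have "magma_isomorphic (quotient_magma M (hom_kernel M (rees_map \<theta>s)))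
      (rees_matrix (quotient_magma S \<theta>s) \<Lambda> (class_map \<theta>s))"
    using M hom[OF \<theta>s sub] surj by (rule first_isomorphism)
  then have iso: "magma_isomorphic (quotient_magma M (theta M))
      (rees_matrix (quotient_magma S \<theta>s) \<Lambda> (class_map \<theta>s))"
    by (simp add: thM kerM[OF \<theta>s])
  show ?thesis
    using hom[OF assms(2,3)] surj iff class_map_surj[OF assms(1) \<theta>s sub] iso
    by (simp add: \<Lambda>_def)
qed

end
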